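(* Let $\Phi=(\phi_1,\phi_2)^\top$ be a stationary state of the coupled Gross-Pitaevskii equations with harmonic trapping potential $V$ with trapping frequencies $\gamma_\sigma>0$ (see context). Then, for $\sigma=x$ if $d=1$, for each $\sigma\in\{x,y\}$ if $d=2$, and for each $\sigma\in\{x,y,z\}$ if $d=3$, the triple $$\{\omega_\sigma;\boldsymbol u_\sigma,\boldsymbol v_\sigma\}:=\Big\{\gamma_\sigma;\ \tfrac1{\sqrt2}\big(\gamma_\sigma^{-1/2}\partial_\sigma\Phi-\gamma_\sigma^{1/2}\sigma\Phi\big),\ \tfrac1{\sqrt2}\big(\gamma_\sigma^{-1/2}\partial_\sigma\overline\Phi+\gamma_\sigma^{1/2}\sigma\overline\Phi\big)\Big\}$$ is a solution of the Bogoliubov-de Gennes equation $$\begin{bmatrix}\mathcal A&\mathcal B\\ \mathcal C&\mathcal D\end{bmatrix}\begin{bmatrix}\boldsymbol u\\ \boldsymbol v\end{bmatrix}=\omega\begin{bmatrix}\boldsymbol u\\ \boldsymbol v\end{bmatrix}\quad\text{with constraint}\quad \int_{\mathbb R^d}\big(|\boldsymbol u|^2-|\boldsymbol v|^2\big)\,d\boldsymbol x=1 .$$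
   Context: Let $d\in\{1,2,3\}$, with Cartesian coordinates $x$, $(x,y)$, $(x,y,z)$ respectively; in expressions such as $\sigma\Phi$, the symbol $\sigma$ denotes multiplication by that coordinate function. The harmonic potential is $V=\frac12\gamma_x^2x^2$ ($d=1$), $V=\frac12(\gamma_x^2x^2+\gamma_y^2y^2)$ ($d=2$), $V=\frac12(\gamma_x^2x^2+\gamma_y^2y^2+\gamma_z^2z^2)$ ($d=3$), all $\gamma_\sigma>0$. Let $\delta\in\mathbb R$, $\Omega\in\mathbb R\setminus\{0\}$, $\beta_{jl}\in\mathbb R$ ($j,l=1,2$) with $\beta_{12}=\beta_{21}$. A stationary state with chemical potential $\mu\in\mathbb R$ is a complex-valued, smooth and fast-decaying (Schwartz) $\Phi=(\phi_1,\phi_2)^\top$ with $\int_{\mathbb R^d}(|\phi_1|^2+|\phi_2|^2)\,d\boldsymbol x=1$ and $$\mu\phi_1=\big[-\tfrac12\nabla^2+V+\tfrac\delta2+\beta_{11}|\phi_1|^2+\beta_{12}|\phi_2|^2\big]\phi_1+\tfrac\Omega2\phi_2,$$ $$\mu\phi_2=\big[-\tfrac12\nabla^2+V-\tfrac\delta2+\beta_{21}|\phi_1|^2+\beta_{22}|\phi_2|^2\big]\phi_2+\tfrac\Omega2\phi_1.$$ Put $$L_1=-\tfrac12\nabla^2+V+\tfrac\delta2+2\beta_{11}|\phi_1|^2+\beta_{12}|\phi_2|^2-\mu,\qquad L_2=-\tfrac12\nabla^2+V-\tfrac\delta2+\beta_{21}|\phi_1|^2+2\beta_{22}|\phi_2|^2-\mu,$$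 $$\mathcal A=\begin{bmatrix}L_1&\beta_{12}\phi_1\overline{\phi_2}+\frac\Omega2\\ \beta_{21}\overline{\phi_1}\phi_2+\frac\Omega2&L_2\end{bmatrix},\qquad \mathcal B=\begin{bmatrix}\beta_{11}\phi_1^2&\beta_{12}\phi_1\phi_2\\ \beta_{21}\phi_1\phi_2&\beta_{22}\phi_2^2\end{bmatrix},$$ $$\mathcal C=-\begin{bmatrix}\beta_{11}\overline{\phi_1}^2&\beta_{12}\overline{\phi_1}\,\overline{\phi_2}\\ \beta_{21}\overline{\phi_1}\,\overline{\phi_2}&\beta_{22}\overline{\phi_2}^2\end{bmatrix},\qquad \mathcal D=-\begin{bmatrix}L_1&\beta_{12}\overline{\phi_1}\phi_2+\frac\Omega2\\ \beta_{21}\phi_1\overline{\phi_2}+\frac\Omega2&L_2\end{bmatrix}.$$ Here $|\boldsymbol u|^2=|u_1|^2+|u_2|^2$ for $\boldsymbol u=(u_1,u_2)^\top$, and a bar denotes complex conjugation. *)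

theory Defs
  imports "HOL-Analysis.Analysis"
begin

definition partial_deriv ::
    "'d::finite \<Rightarrow> (real^'d \<Rightarrow> 'b::real_normed_vector) \<Rightarrow> real^'d \<Rightarrow> 'b" where
  "partial_deriv i f x = vector_derivative (\<lambda>t. f (x + t *\<^sub>R axis i 1)) (at 0)"

definition laplacian ::
    "(real^'d::finite \<Rightarrow> 'b::real_normed_vector) \<Rightarrow> real^'d \<Rightarrow> 'b" where
  "laplacian f x = (\<Sum>i\<in>UNIV. partial_deriv i (partial_deriv i f) x)"

text \<open>A list of coordinate directions plays the role of a multi-index.  Total differentiability
  of all iterated partial derivatives is equivalent to \<open>f\<close> being infinitely differentiable,
  and it ensures that \<open>partial_deriv\<close> is never applied where the derivative does not exist.\<close>

definition schwartz :: "(real^'d::finite \<Rightarrow> 'b::real_normed_vector) \<Rightarrow> bool" where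
  "schwartz f \<longleftrightarrow>
     (\<forall>is. (\<forall>x. foldr partial_deriv is f differentiable (at x)) \<and>
           (\<forall>k::nat. bounded (range (\<lambda>x. norm x ^ k *\<^sub>R foldr partial_deriv is f x))))"

definition conj_field :: "(real^'d \<Rightarrow> complex^2) \<Rightarrow> real^'d \<Rightarrow> complex^2" where
  "conj_field \<Phi> x = (\<chi> j. cnj (\<Phi> x $ j))"

definition harmonic_potential :: "real^'d::finite \<Rightarrow> real^'d \<Rightarrow> real" where
  "harmonic_potential \<gamma> x = (1/2) * (\<Sum>i\<in>UNIV. (\<gamma> $ i)\<^sup>2 * (x $ i)\<^sup>2)"

definition stationary_state ::
    "real^'d::finite \<Rightarrow> real \<Rightarrow> real \<Rightarrow> real^2^2 \<Rightarrow> real \<Rightarrow> (real^'d \<Rightarrow> complex^2) \<Rightarrow> bool" where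
  "stationary_state \<gamma> \<delta> \<Omega> \<beta> \<mu> \<Phi> \<longleftrightarrow>
     schwartz \<Phi> \<and>
     (\<integral>x. (cmod (\<Phi> x $ 1))\<^sup>2 + (cmod (\<Phi> x $ 2))\<^sup>2 \<partial>lborel) = 1 \<and>
     (\<forall>x. \<mu> *\<^sub>R \<Phi> x $ 1 =
        (-1/2) *\<^sub>R laplacian (\<lambda>y. \<Phi> y $ 1) x
        + (harmonic_potential \<gamma> x + \<delta>/2
           + \<beta>$1$1 * (cmod (\<Phi> x $ 1))\<^sup>2 + \<beta>$1$2 * (cmod (\<Phi> x $ 2))\<^sup>2) *\<^sub>R \<Phi> x $ 1
        + (\<Omega>/2) *\<^sub>R \<Phi> x $ 2) \<and>
     (\<forall>x. \<mu> *\<^sub>R \<Phi> x $ 2 =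
        (-1/2) *\<^sub>R laplacian (\<lambda>y. \<Phi> y $ 2) x
        + (harmonic_potential \<gamma> x - \<delta>/2
           + \<beta>$2$1 * (cmod (\<Phi> x $ 1))\<^sup>2 + \<beta>$2$2 * (cmod (\<Phi> x $ 2))\<^sup>2) *\<^sub>R \<Phi> x $ 2
        + (\<Omega>/2) *\<^sub>R \<Phi> x $ 1)"

definition L1 ::
    "real^'d::finite \<Rightarrow> real \<Rightarrow> real^2^2 \<Rightarrow> real \<Rightarrow> (real^'d \<Rightarrow> complex^2)
      \<Rightarrow> (real^'d \<Rightarrow> complex) \<Rightarrow> real^'d \<Rightarrow> complex" where
  "L1 \<gamma> \<delta> \<beta> \<mu> \<Phi> f x =
     (-1/2) *\<^sub>R laplacian f x
     + (harmonic_potential \<gamma> x + \<delta>/2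
        + 2 * \<beta>$1$1 * (cmod (\<Phi> x $ 1))\<^sup>2 + \<beta>$1$2 * (cmod (\<Phi> x $ 2))\<^sup>2 - \<mu>) *\<^sub>R f x"

definition L2 ::
    "real^'d::finite \<Rightarrow> real \<Rightarrow> real^2^2 \<Rightarrow> real \<Rightarrow> (real^'d \<Rightarrow> complex^2)
      \<Rightarrow> (real^'d \<Rightarrow> complex) \<Rightarrow> real^'d \<Rightarrow> complex" where
  "L2 \<gamma> \<delta> \<beta> \<mu> \<Phi> f x =
     (-1/2) *\<^sub>R laplacian f x
     + (harmonic_potential \<gamma> x - \<delta>/2
        + \<beta>$2$1 * (cmod (\<Phi> x $ 1))\<^sup>2 + 2 * \<beta>$2$2 * (cmod (\<Phi> x $ 2))\<^sup>2 - \<mu>) *\<^sub>R f x"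

text \<open>The four \<open>2 \<times> 2\<close> blocks of the Bogoliubov-de Gennes operator.  The diagonal entries of
  \<open>bdg_A\<close> and \<open>bdg_D\<close> are differential operators, so these two blocks are given by their action
  on two-component functions; \<open>bdg_B\<close> and \<open>bdg_C\<close> are pointwise matrix multiplications.\<close>

definition bdg_A ::
    "real^'d::finite \<Rightarrow> real \<Rightarrow> real \<Rightarrow> real^2^2 \<Rightarrow> real \<Rightarrow> (real^'d \<Rightarrow> complex^2)
      \<Rightarrow> (real^'d \<Rightarrow> complex^2) \<Rightarrow> real^'d \<Rightarrow> complex^2" where
  "bdg_A \<gamma> \<delta> \<Omega> \<beta> \<mu> \<Phi> u x = vector
     [L1 \<gamma> \<delta> \<beta> \<mu> \<Phi> (\<lambda>y. u y $ 1) x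
        + (of_real (\<beta>$1$2) * \<Phi> x $ 1 * cnj (\<Phi> x $ 2) + of_real (\<Omega>/2)) * u x $ 2,
      (of_real (\<beta>$2$1) * cnj (\<Phi> x $ 1) * \<Phi> x $ 2 + of_real (\<Omega>/2)) * u x $ 1
        + L2 \<gamma> \<delta> \<beta> \<mu> \<Phi> (\<lambda>y. u y $ 2) x]"

definition bdg_B :: "real^2^2 \<Rightarrow> (real^'d \<Rightarrow> complex^2) \<Rightarrow> real^'d \<Rightarrow> complex^2^2" where
  "bdg_B \<beta> \<Phi> x = vector
     [vector [of_real (\<beta>$1$1) * (\<Phi> x $ 1)\<^sup>2, of_real (\<beta>$1$2) * \<Phi> x $ 1 * \<Phi> x $ 2],
      vector [of_real (\<beta>$2$1) * \<Phi> x $ 1 * \<Phi> x $ 2, of_real (\<beta>$2$2) * (\<Phi> x $ 2)\<^sup>2]]"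

definition bdg_C :: "real^2^2 \<Rightarrow> (real^'d \<Rightarrow> complex^2) \<Rightarrow> real^'d \<Rightarrow> complex^2^2" where
  "bdg_C \<beta> \<Phi> x = - vector
     [vector [of_real (\<beta>$1$1) * (cnj (\<Phi> x $ 1))\<^sup>2,
              of_real (\<beta>$1$2) * cnj (\<Phi> x $ 1) * cnj (\<Phi> x $ 2)],
      vector [of_real (\<beta>$2$1) * cnj (\<Phi> x $ 1) * cnj (\<Phi> x $ 2),
              of_real (\<beta>$2$2) * (cnj (\<Phi> x $ 2))\<^sup>2]]"

definition bdg_D ::
    "real^'d::finite \<Rightarrow> real \<Rightarrow> real \<Rightarrow> real^2^2 \<Rightarrow> real \<Rightarrow> (real^'d \<Rightarrow> complex^2)
      \<Rightarrow> (real^'d \<Rightarrow> complex^2) \<Rightarrow> real^'d \<Rightarrow> complex^2" where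
  "bdg_D \<gamma> \<delta> \<Omega> \<beta> \<mu> \<Phi> v x = - vector
     [L1 \<gamma> \<delta> \<beta> \<mu> \<Phi> (\<lambda>y. v y $ 1) x
        + (of_real (\<beta>$1$2) * cnj (\<Phi> x $ 1) * \<Phi> x $ 2 + of_real (\<Omega>/2)) * v x $ 2,
      (of_real (\<beta>$2$1) * \<Phi> x $ 1 * cnj (\<Phi> x $ 2) + of_real (\<Omega>/2)) * v x $ 1
        + L2 \<gamma> \<delta> \<beta> \<mu> \<Phi> (\<lambda>y. v y $ 2) x]"

text \<open>The eigenvalue equation is read pointwise.  Since a Bochner integral of a non-integrable
  function is \<open>0\<close>, the normalisations to \<open>1\<close> here and in \<open>stationary_state\<close> entail integrability.\<close>

definition bdg_solution ::
    "real^'d::finite \<Rightarrow> real \<Rightarrow> real \<Rightarrow> real^2^2 \<Rightarrow> real \<Rightarrow> (real^'d \<Rightarrow> complex^2)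
      \<Rightarrow> real \<Rightarrow> (real^'d \<Rightarrow> complex^2) \<Rightarrow> (real^'d \<Rightarrow> complex^2) \<Rightarrow> bool" where
  "bdg_solution \<gamma> \<delta> \<Omega> \<beta> \<mu> \<Phi> \<omega> u v \<longleftrightarrow>
     (\<forall>x. bdg_A \<gamma> \<delta> \<Omega> \<beta> \<mu> \<Phi> u x + bdg_B \<beta> \<Phi> x *v v x = \<omega> *\<^sub>R u x) \<and>
     (\<forall>x. bdg_C \<beta> \<Phi> x *v u x + bdg_D \<gamma> \<delta> \<Omega> \<beta> \<mu> \<Phi> v x = \<omega> *\<^sub>R v x) \<and>
     (\<integral>x. (norm (u x))\<^sup>2 - (norm (v x))\<^sup>2 \<partial>lborel) = 1"

end

theory Submission
  imports Defs "HOL-Probability.Sinc_Integral"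
begin

text \<open>Differentiating the Gross-Pitaevskii equations along \<open>x\<^sub>\<sigma>\<close> gives
  \<open>A \<partial>\<Phi> + B \<partial>\<Phi>\<^sup>* = - \<gamma>\<^sup>2 x\<^sub>\<sigma> \<Phi>\<close>, because mixed partial derivatives commute and
  \<open>\<partial>V = \<gamma>\<^sup>2 x\<^sub>\<sigma>\<close>; multiplying them by \<open>x\<^sub>\<sigma>\<close> gives \<open>A (x\<^sub>\<sigma> \<Phi>) - B (x\<^sub>\<sigma> \<Phi>\<^sup>*) = - \<partial>\<Phi>\<close>,
  because \<open>\<nabla>\<^sup>2 (x\<^sub>\<sigma> f) = x\<^sub>\<sigma> \<nabla>\<^sup>2 f + 2 \<partial>f\<close>.  The ladder combinations of \<open>\<partial>\<Phi>\<close> and \<open>x\<^sub>\<sigma> \<Phi>\<close>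
  diagonalise this pair; the second row of the system is the first one for the conjugate field.
  Finally \<open>\<bar>u\<bar>\<^sup>2 - \<bar>v\<bar>\<^sup>2 = - x\<^sub>\<sigma> \<partial>\<bar>\<Phi>\<bar>\<^sup>2\<close>, which integrates to \<open>\<integral> \<bar>\<Phi>\<bar>\<^sup>2 = 1\<close>.\<close>

section \<open>Partial derivatives\<close>

text \<open>The derivative half of \<open>schwartz\<close>, kept apart from decay. It passes to
  partial derivatives and bounded linear images, and the eigenvalue identity is derived from
  it.\<close>

definition smooth :: "(real^'d::finite \<Rightarrow> 'b::real_normed_vector) \<Rightarrow> bool" where
  "smooth f \<longleftrightarrow> (\<forall>is x. foldr partial_deriv is f differentiable (at x))"

text \<open>Chain rule along an affine line: the derivative at parameter \<open>s\<close> and the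
  partial derivative at the point reached are both the Frechet derivative applied to
  \<open>axis i 1\<close>. The mean value theorem needs every \<open>s\<close>, while
  \<open>partial_deriv\<close> differentiates at \<open>0\<close>.\<close>

lemma has_vector_derivative_line:
  fixes f :: "real^'d::finite \<Rightarrow> 'b::real_normed_vector"
  assumes "f differentiable (at (x + s *\<^sub>R axis i 1))"
  shows "((\<lambda>t. f (x + t *\<^sub>R axis i 1)) has_vector_derivative
           partial_deriv i f (x + s *\<^sub>R axis i 1)) (at s)"
proof -
  from assms obtain D where D: "(f has_derivative D) (at (x + s *\<^sub>R axis i 1))"
    by (auto simp: differentiable_def)
  then have lin: "linear D" by (rule has_derivative_linear)
  have *: "((\<lambda>t. f (y + t *\<^sub>R axis i 1)) has_vector_derivative D (axis i 1)) (at r)"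
    if "y + r *\<^sub>R axis i 1 = x + s *\<^sub>R axis i 1" for y r
  proof -
    have "((\<lambda>t. y + t *\<^sub>R axis i 1) has_derivative (\<lambda>h. h *\<^sub>R axis i 1)) (at r)"
      by (auto intro!: derivative_eq_intros)
    from has_derivative_compose[OF this] D that
    have "((\<lambda>t. f (y + t *\<^sub>R axis i 1)) has_derivative (\<lambda>h. D (h *\<^sub>R axis i 1))) (at r)"
      by simp
    then show ?thesis
      by (simp add: has_vector_derivative_def linear_cmul[OF lin])
  qed
  have "partial_deriv i f (x + s *\<^sub>R axis i 1) = D (axis i 1)"
    unfolding partial_deriv_def by (rule vector_derivative_at, rule *) simp
  then show ?thesis using *[of x s] by simp
qed

lemma has_vector_derivative_partial_deriv:
  fixes f :: "real^'d::finite \<Rightarrow> 'b::real_normed_vector"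
  assumes "f differentiable (at x)"
  shows "((\<lambda>t. f (x + t *\<^sub>R axis i 1)) has_vector_derivative partial_deriv i f x) (at 0)"
  using has_vector_derivative_line[of f x 0 i] assms by simp

lemma partial_derivI:
  "((\<lambda>t. f (x + t *\<^sub>R axis i 1)) has_vector_derivative D) (at 0) \<Longrightarrow> partial_deriv i f x = D"
  unfolding partial_deriv_def by (rule vector_derivative_at)

lemma partial_deriv_bounded_linear:
  fixes f :: "real^'d::finite \<Rightarrow> 'b::real_normed_vector"
  assumes "bounded_linear L" "f differentiable (at x)"
  shows "partial_deriv i (\<lambda>y. L (f y)) x = L (partial_deriv i f x)"
  by (rule partial_derivI, rule bounded_linear.has_vector_derivative[OF assms(1)],
      rule has_vector_derivative_partial_deriv[OF assms(2)])

lemma partial_deriv_add: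
  fixes f g :: "real^'d::finite \<Rightarrow> 'b::real_normed_vector"
  assumes "f differentiable (at x)" "g differentiable (at x)"
  shows "partial_deriv i (\<lambda>y. f y + g y) x = partial_deriv i f x + partial_deriv i g x"
  by (rule partial_derivI, intro has_vector_derivative_add
      has_vector_derivative_partial_deriv assms)

lemma partial_deriv_mult:
  fixes f g :: "real^'d::finite \<Rightarrow> 'b::real_normed_algebra"
  assumes "f differentiable (at x)" "g differentiable (at x)"
  shows "partial_deriv i (\<lambda>y. f y * g y) x = f x * partial_deriv i g x + partial_deriv i f x * g x"
  using has_vector_derivative_mult[OF has_vector_derivative_partial_deriv[OF assms(1), of i]
      has_vector_derivative_partial_deriv[OF assms(2), of i]]
  by (intro partial_derivI) simp

lemma partial_deriv_cmult:
  fixes f :: "real^'d::finite \<Rightarrow> 'b::real_normed_algebra"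
  assumes "f differentiable (at x)"
  shows "partial_deriv i (\<lambda>y. c * f y) x = c * partial_deriv i f x"
  by (rule partial_deriv_bounded_linear[OF bounded_linear_mult_right assms])

section \<open>Derivatives of the coordinate functions and of the potential\<close>

lemma bounded_linear_coordinate:
  "bounded_linear (\<lambda>y::real^'d::finite. of_real (y $ j) :: 'b::real_normed_algebra_1)"
  by (rule bounded_linear_compose[OF bounded_linear_of_real bounded_linear_vec_nth])

lemma differentiable_coordinate:
  "(\<lambda>y::real^'d::finite. of_real (y $ j) :: 'b::real_normed_algebra_1) differentiable (at x)"
  by (rule bounded_linear_imp_differentiable[OF bounded_linear_coordinate])

lemma partial_deriv_coordinate:
  "partial_deriv i (\<lambda>y::real^'d::finite. of_real (y $ j) :: 'b::real_normed_algebra_1) x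
     = (if i = j then 1 else 0)"
proof -
  have "partial_deriv i (\<lambda>y::real^'d. y) x = axis i 1"
    by (rule partial_derivI) (auto intro!: derivative_eq_intros)
  then show ?thesis
    using partial_deriv_bounded_linear[OF bounded_linear_coordinate, of "\<lambda>y. y" x i j]
    by (auto simp: axis_def)
qed

lemma harmonic_potential_derivative:
  fixes \<gamma> :: "real^'a::finite"
  shows "(\<lambda>y. of_real (harmonic_potential \<gamma> y) :: complex) differentiable (at x)" (is ?A)
    and "partial_deriv i (\<lambda>y. of_real (harmonic_potential \<gamma> y) :: complex) x
           = of_real ((\<gamma> $ i)\<^sup>2 * x $ i)" (is ?B)
proof -
  have D: "(harmonic_potential \<gamma> has_derivative (\<lambda>h. \<Sum>j\<in>UNIV. (\<gamma> $ j)\<^sup>2 * x $ j * h $ j)) (at x)"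
    unfolding harmonic_potential_def[abs_def]
    by (auto intro!: derivative_eq_intros ext bounded_linear_imp_has_derivative[OF bounded_linear_vec_nth]
        simp: sum_distrib_left power2_eq_square algebra_simps)
  have diff: "harmonic_potential \<gamma> differentiable (at x)"
    using D by (auto simp: differentiable_def)
  have "((\<lambda>t. x + t *\<^sub>R axis i 1) has_derivative (\<lambda>h. h *\<^sub>R axis i 1)) (at 0)"
    by (auto intro!: derivative_eq_intros)
  then have "((\<lambda>t. harmonic_potential \<gamma> (x + t *\<^sub>R axis i 1)) has_derivative
      (\<lambda>h. \<Sum>j\<in>UNIV. (\<gamma> $ j)\<^sup>2 * x $ j * (h *\<^sub>R axis i 1 :: real^'a) $ j)) (at 0)"
    by (rule has_derivative_compose) (simp add: D)
  moreover have "(\<Sum>j\<in>UNIV. (\<gamma> $ j)\<^sup>2 * x $ j * (h *\<^sub>R axis i 1 :: real^'a) $ j) = h * ((\<gamma> $ i)\<^sup>2 * x $ i)" for h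
    by (simp add: axis_def if_distrib cong: if_cong)
  ultimately
  have "((\<lambda>t. harmonic_potential \<gamma> (x + t *\<^sub>R axis i 1)) has_vector_derivative (\<gamma> $ i)\<^sup>2 * x $ i) (at 0)"
    by (simp add: has_vector_derivative_def)
  then have P: "partial_deriv i (harmonic_potential \<gamma>) x = (\<gamma> $ i)\<^sup>2 * x $ i"
    by (rule partial_derivI)
  show ?A
    using differentiable_compose[OF bounded_linear_imp_differentiable[OF bounded_linear_of_real] diff]
    by simp
  show ?B
    using partial_deriv_bounded_linear[OF bounded_linear_of_real diff, of i] P by simp
qed

section \<open>Smooth functions and commuting partial derivatives\<close>

lemma smooth_differentiable: "smooth f \<Longrightarrow> f differentiable (at x)"
  unfolding smooth_def by (metis foldr.simps(1) id_apply)

lemma smooth_partial_deriv: "smooth f \<Longrightarrow> smooth (partial_deriv i f)"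
  unfolding smooth_def
proof (intro allI)
  fix "is" x
  assume "\<forall>is x. foldr partial_deriv is f differentiable (at x)"
  \<comment> \<open>\<open>foldr\<close> applies the last entry of the list first, so appending
    \<open>i\<close> makes it the innermost derivative.\<close>
  then have "foldr partial_deriv (is @ [i]) f differentiable (at x)" by blast
  then show "foldr partial_deriv is (partial_deriv i f) differentiable (at x)" by simp
qed

text \<open>Linearity is meant over the reals, so this covers vector components, real and imaginary
  parts, and also complex conjugation.\<close>

lemma foldr_partial_deriv_bounded_linear:
  assumes "bounded_linear L" "smooth f"
  shows "foldr partial_deriv is (\<lambda>y. L (f y)) = (\<lambda>y. L (foldr partial_deriv is f y))"
proof (induction "is")
  case (Cons i js)
  have "foldr partial_deriv js f differentiable (at x)" for x
    using assms(2) by (simp add: smooth_def)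
  then show ?case using Cons by (intro ext) (simp add: partial_deriv_bounded_linear[OF assms(1)])
qed simp

lemma smooth_bounded_linear:
  assumes "bounded_linear L" "smooth f"
  shows "smooth (\<lambda>y. L (f y))"
  unfolding smooth_def foldr_partial_deriv_bounded_linear[OF assms]
proof (intro allI)
  fix "is" x
  have "foldr partial_deriv is f differentiable (at x)"
    using assms(2) by (simp add: smooth_def)
  then show "(\<lambda>y. L (foldr partial_deriv is f y)) differentiable (at x)"
    using differentiable_compose[OF bounded_linear_imp_differentiable[OF assms(1)]] by blast
qed

section \<open>Mean value theorem and symmetry of second derivatives\<close>

lemma partial_deriv_mean_value:
  fixes f :: "real^'d::finite \<Rightarrow> real"
  assumes "\<And>x. f differentiable (at x)" "h > 0"
  shows "\<exists>s. 0 < s \<and> s < h \<and>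
           f (x + h *\<^sub>R axis i 1) - f x = h * partial_deriv i f (x + s *\<^sub>R axis i 1)"
proof -
  have "((\<lambda>t. f (x + t *\<^sub>R axis i 1)) has_real_derivative partial_deriv i f (x + s *\<^sub>R axis i 1)) (at s)" for s
    using has_vector_derivative_line[OF assms(1)]
    by (simp add: has_real_derivative_iff_has_vector_derivative)
  from MVT2[OF assms(2) this] show ?thesis by auto
qed

text \<open>Applying the mean value theorem twice writes the second difference of \<open>f\<close> over a square
  of side \<open>h\<close> as \<open>h\<^sup>2\<close> times the mixed derivative, in either order, at a point of the square.\<close>

lemma second_difference_mean_value:
  fixes f :: "real^'d::finite \<Rightarrow> real"
  assumes "smooth f" "h > 0"
  shows "\<exists>y. norm (y - x) < 2 * h \<and>
    f (x + h *\<^sub>R axis i 1 + h *\<^sub>R axis j 1) - f (x + h *\<^sub>R axis i 1) - f (x + h *\<^sub>R axis j 1) + f x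
      = h\<^sup>2 * partial_deriv j (partial_deriv i f) y"
proof -
  \<comment> \<open>The second difference of \<open>f\<close> is the first difference of
    \<open>g\<close> in direction \<open>i\<close>. The mean value theorem is applied to
    \<open>g\<close> along \<open>i\<close>, then to \<open>partial_deriv i f\<close> along
    \<open>j\<close>.\<close>
  define g where "g y = f (y + h *\<^sub>R axis j 1) - f y" for y
  have f: "f differentiable (at y)" for y by (rule smooth_differentiable[OF assms(1)])
  have fs: "(\<lambda>y. f (y + h *\<^sub>R axis j 1)) differentiable (at y)" for y
    by (rule differentiable_compose[of f]) (auto intro: f)
  have g: "g differentiable (at y)" for y
    unfolding g_def[abs_def] using f fs by (intro differentiable_diff)
  have Pg: "partial_deriv i g y = partial_deriv i f (y + h *\<^sub>R axis j 1) - partial_deriv i f y" for y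
  proof (rule partial_derivI)
    show "((\<lambda>t. g (y + t *\<^sub>R axis i 1)) has_vector_derivative
       partial_deriv i f (y + h *\<^sub>R axis j 1) - partial_deriv i f y) (at 0)"
      unfolding g_def
      using has_vector_derivative_partial_deriv[OF f, of "y + h *\<^sub>R axis j 1" i]
        has_vector_derivative_partial_deriv[OF f, of y i]
      by (intro has_vector_derivative_diff) (simp_all add: add_ac)
  qed
  obtain s where s: "0 < s" "s < h" "g (x + h *\<^sub>R axis i 1) - g x = h * partial_deriv i g (x + s *\<^sub>R axis i 1)"
    using partial_deriv_mean_value[OF g assms(2)] by blast
  obtain r where r: "0 < r" "r < h"
     "partial_deriv i f (x + s *\<^sub>R axis i 1 + h *\<^sub>R axis j 1) - partial_deriv i f (x + s *\<^sub>R axis i 1)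
       = h * partial_deriv j (partial_deriv i f) (x + s *\<^sub>R axis i 1 + r *\<^sub>R axis j 1)"
    using partial_deriv_mean_value[OF smooth_differentiable[OF smooth_partial_deriv[OF assms(1)]] assms(2)]
    by blast
  have "norm (s *\<^sub>R axis i 1 + r *\<^sub>R axis j (1::real)) \<le> s + r"
    using s(1) r(1) by (intro norm_triangle_le) (simp add: norm_axis_1)
  then have "norm (x + s *\<^sub>R axis i 1 + r *\<^sub>R axis j 1 - x) < 2 * h"
    using s(2) r(2) by (simp add: add.assoc)
  moreover have "f (x + h *\<^sub>R axis i 1 + h *\<^sub>R axis j 1) - f (x + h *\<^sub>R axis i 1) - f (x + h *\<^sub>R axis j 1) + f x
      = h\<^sup>2 * partial_deriv j (partial_deriv i f) (x + s *\<^sub>R axis i 1 + r *\<^sub>R axis j 1)"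
    using s(3) r(3) Pg[of "x + s *\<^sub>R axis i 1"] by (simp add: g_def power2_eq_square)
  ultimately show ?thesis by blast
qed

text \<open>Both mixed derivatives reproduce the same second difference quotient at points within
  \<open>2 * h\<close> of \<open>x\<close>; their continuity at \<open>x\<close> closes the
  gap.\<close>

lemma partial_deriv_commute_real:
  fixes f :: "real^'d::finite \<Rightarrow> real"
  assumes "smooth f"
  shows "partial_deriv i (partial_deriv j f) x = partial_deriv j (partial_deriv i f) x"
proof -
  let ?A = "partial_deriv i (partial_deriv j f)" and ?B = "partial_deriv j (partial_deriv i f)"
  have cont: "continuous (at x) ?A" "continuous (at x) ?B"
    using assms by (auto intro!: differentiable_imp_continuous_within
        smooth_differentiable smooth_partial_deriv)
  have "\<bar>?A x - ?B x\<bar> < e" if "e > 0" for e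
  proof -
    obtain d1 where d1: "d1 > 0" "\<And>y. norm (y - x) < d1 \<Longrightarrow> norm (?A y - ?A x) < e/2"
      using cont(1) \<open>e > 0\<close> unfolding continuous_at_eps_delta dist_norm by (meson half_gt_zero)
    obtain d2 where d2: "d2 > 0" "\<And>y. norm (y - x) < d2 \<Longrightarrow> norm (?B y - ?B x) < e/2"
      using cont(2) \<open>e > 0\<close> unfolding continuous_at_eps_delta dist_norm by (meson half_gt_zero)
    define h where "h = min d1 d2 / 2"
    have h: "h > 0" "2 * h \<le> d1" "2 * h \<le> d2" using d1(1) d2(1) by (auto simp: h_def)
    obtain y where y: "norm (y - x) < 2 * h"
      "f (x + h *\<^sub>R axis i 1 + h *\<^sub>R axis j 1) - f (x + h *\<^sub>R axis i 1) - f (x + h *\<^sub>R axis j 1) + f x = h\<^sup>2 * ?B y"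
      using second_difference_mean_value[OF assms h(1)] by blast
    \<comment> \<open>Exchanging \<open>i\<close> and \<open>j\<close> leaves the second difference
      unchanged but yields the other order of differentiation.\<close>
    obtain z where z: "norm (z - x) < 2 * h"
      "f (x + h *\<^sub>R axis j 1 + h *\<^sub>R axis i 1) - f (x + h *\<^sub>R axis j 1) - f (x + h *\<^sub>R axis i 1) + f x = h\<^sup>2 * ?A z"
      using second_difference_mean_value[OF assms h(1)] by blast
    have *: "x + h *\<^sub>R axis j 1 + h *\<^sub>R axis i 1 = x + h *\<^sub>R axis i 1 + h *\<^sub>R axis j (1::real)"
      by (simp add: add_ac)
    have "h\<^sup>2 * ?B y = h\<^sup>2 * ?A z" using y(2) z(2) unfolding * by linarith
    then have "?B y = ?A z" using h(1) by simp
    moreover have "norm (?B y - ?B x) < e/2" "norm (?A z - ?A x) < e/2"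
      using d1(2) d2(2) y(1) z(1) h(2,3) by auto
    ultimately show ?thesis by (simp add: abs_if split: if_splits)
  qed
  then show ?thesis by (metis abs_0 eq_iff_diff_eq_0 less_irrefl zero_less_abs_iff)
qed

text \<open>The mean value theorem is a statement about real functions, so the complex case is read
  off from \<open>Re\<close> and \<open>Im\<close>.\<close>

lemma partial_deriv_commute:
  fixes f :: "real^'d::finite \<Rightarrow> complex"
  assumes "smooth f"
  shows "partial_deriv i (partial_deriv j f) = partial_deriv j (partial_deriv i f)"
proof
  fix x
  have *: "L (partial_deriv i (partial_deriv j f) x) = L (partial_deriv j (partial_deriv i f) x)"
    if "bounded_linear L" for L :: "complex \<Rightarrow> real"
    using partial_deriv_commute_real[OF smooth_bounded_linear[OF that assms], of i j x]
      foldr_partial_deriv_bounded_linear[OF that assms, of "[i,j]"]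
      foldr_partial_deriv_bounded_linear[OF that assms, of "[j,i]"]
    by simp
  show "partial_deriv i (partial_deriv j f) x = partial_deriv j (partial_deriv i f) x"
    by (rule complex_eqI) (auto intro!: * bounded_linear_Re bounded_linear_Im)
qed

section \<open>The Laplacian of derivatives and of ladder combinations\<close>

lemma laplacian_bounded_linear:
  assumes "bounded_linear L" "smooth f"
  shows "laplacian (\<lambda>y. L (f y)) x = L (laplacian f x)"
  using foldr_partial_deriv_bounded_linear[OF assms, of "[i,i]" for i]
  by (simp add: laplacian_def bounded_linear.linear[OF assms(1)] linear_sum)

lemma partial_deriv_sum:
  fixes f :: "'i \<Rightarrow> real^'d::finite \<Rightarrow> 'b::real_normed_vector"
  assumes "finite I" "\<And>k. k \<in> I \<Longrightarrow> f k differentiable (at x)"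
  shows "(\<lambda>y. \<Sum>k\<in>I. f k y) differentiable (at x)"
    and "partial_deriv i (\<lambda>y. \<Sum>k\<in>I. f k y) x = (\<Sum>k\<in>I. partial_deriv i (f k) x)"
proof -
  show "(\<lambda>y. \<Sum>k\<in>I. f k y) differentiable (at x)"
    using assms by (intro differentiable_sum) auto
  show "partial_deriv i (\<lambda>y. \<Sum>k\<in>I. f k y) x = (\<Sum>k\<in>I. partial_deriv i (f k) x)"
    using assms by (intro partial_derivI has_vector_derivative_sum
        has_vector_derivative_partial_deriv) auto
qed

lemma partial_deriv_laplacian:
  fixes f :: "real^'d::finite \<Rightarrow> complex"
  assumes "smooth f"
  shows "laplacian f differentiable (at x)"
    and "partial_deriv i (laplacian f) x = laplacian (partial_deriv i f) x"
proof -
  have d: "partial_deriv k (partial_deriv k f) differentiable (at x)" for k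
    using assms by (intro smooth_differentiable smooth_partial_deriv)
  have lap: "laplacian f = (\<lambda>x. \<Sum>k\<in>UNIV. partial_deriv k (partial_deriv k f) x)"
    by (simp add: laplacian_def fun_eq_iff)
  show "laplacian f differentiable (at x)"
    unfolding lap using d by (rule partial_deriv_sum(1)[OF finite])
  have "partial_deriv i (laplacian f) x = (\<Sum>k\<in>UNIV. partial_deriv i (partial_deriv k (partial_deriv k f)) x)"
    unfolding lap using d by (rule partial_deriv_sum(2)[OF finite])
  also have "\<dots> = laplacian (partial_deriv i f) x"
    unfolding laplacian_def
    \<comment> \<open>Commutation for \<open>partial_deriv k f\<close> carries
      \<open>partial_deriv i\<close> past the outer derivative, commutation for \<open>f\<close>
      past the inner one.\<close>
    using partial_deriv_commute[OF assms] partial_deriv_commute[OF smooth_partial_deriv[OF assms]]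
    by (intro sum.cong) metis+
  finally show "partial_deriv i (laplacian f) x = laplacian (partial_deriv i f) x" .
qed

text \<open>Leibniz rule: the coordinate has zero second derivatives, and its gradient is the unit
  vector in direction \<open>i\<close>, so the cross term is twice \<open>partial_deriv i f\<close>.
  Free \<open>s\<close> and \<open>t\<close> serve both ladder combinations.\<close>

lemma laplacian_ladder:
  fixes f :: "real^'d::finite \<Rightarrow> complex"
  assumes "smooth f"
  shows "laplacian (\<lambda>y. s * partial_deriv i f y + t * (of_real (y $ i) * f y)) x
    = s * laplacian (partial_deriv i f) x + t * (of_real (x $ i) * laplacian f x + 2 * partial_deriv i f x)"
proof -
  let ?P = partial_deriv and ?c = "\<lambda>y::real^'d. of_real (y $ i) :: complex"
  note D = smooth_differentiable[OF assms] smooth_differentiable[OF smooth_partial_deriv[OF assms]]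
    smooth_differentiable[OF smooth_partial_deriv[OF smooth_partial_deriv[OF assms]]]
    differentiable_coordinate differentiable_add differentiable_mult differentiable_const
  have 1: "?P k (\<lambda>y. s * ?P i f y + t * (?c y * f y))
     = (\<lambda>y. s * ?P k (?P i f) y + t * (?c y * ?P k f y + (if k = i then 1 else 0) * f y))" for k
    by (rule ext) (simp add: partial_deriv_add partial_deriv_cmult partial_deriv_mult D
        partial_deriv_coordinate del: mult_eq_0_iff)
  have 2: "?P k (\<lambda>y. s * ?P k (?P i f) y + t * (?c y * ?P k f y + (if k = i then 1 else 0) * f y)) x
     = s * ?P k (?P k (?P i f)) x + t * (?c x * ?P k (?P k f) x) + (if k = i then t * (2 * ?P i f x) else 0)" for k
    by (subst partial_deriv_add partial_deriv_cmult partial_deriv_mult;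
        (intro D)?)+ (simp add: partial_deriv_coordinate algebra_simps)
  show ?thesis
    unfolding laplacian_def 1 2
    by (simp add: sum.distrib sum_distrib_left algebra_simps)
qed

section \<open>The eigenvalue equation\<close>

text \<open>The conclusion is \<open>s\<close> times the \<open>i\<close>-th derivative of the hypothesis plus \<open>t x\<^sub>i\<close> times the
  hypothesis.  With \<open>t = - s \<gamma>\<^sub>i\<close> its right-hand side is \<open>\<gamma>\<^sub>i\<close> times the first component of \<open>u\<close>;
  applied to the conjugate field with \<open>t = s \<gamma>\<^sub>i\<close>, it is \<open>- \<gamma>\<^sub>i\<close> times the first component of \<open>v\<close>.\<close>

lemma linearized_component:
  fixes a b :: "real^'d::finite \<Rightarrow> complex"
  assumes a: "smooth a" and b: "smooth b"
    and E: "\<And>x. \<mu> * a x = - (1/2) * laplacian a x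
      + (of_real (harmonic_potential \<gamma> x) + c + \<beta> * (a x * cnj (a x)) + \<beta>' * (b x * cnj (b x))) * a x
      + w * b x"
  shows "- (1/2) * laplacian (\<lambda>y. s * partial_deriv i a y + t * (of_real (y $ i) * a y)) x
    + (of_real (harmonic_potential \<gamma> x) + c + 2 * \<beta> * (a x * cnj (a x)) + \<beta>' * (b x * cnj (b x)) - \<mu>)
        * (s * partial_deriv i a x + t * (of_real (x $ i) * a x))
    + (\<beta>' * a x * cnj (b x) + w) * (s * partial_deriv i b x + t * (of_real (x $ i) * b x))
    + \<beta> * (a x)\<^sup>2 * (s * cnj (partial_deriv i a x) - t * (of_real (x $ i) * cnj (a x)))
    + \<beta>' * a x * b x * (s * cnj (partial_deriv i b x) - t * (of_real (x $ i) * cnj (b x)))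
    = - s * of_real ((\<gamma> $ i)\<^sup>2) * (of_real (x $ i) * a x) - t * partial_deriv i a x"
proof -
  let ?P = partial_deriv
  note D = smooth_differentiable[OF a] smooth_differentiable[OF b]
    smooth_differentiable[OF smooth_bounded_linear[OF bounded_linear_cnj a]]
    smooth_differentiable[OF smooth_bounded_linear[OF bounded_linear_cnj b]]
    partial_deriv_laplacian(1)[OF a] harmonic_potential_derivative(1)
  have const: "?P i (\<lambda>_. k) x = 0" for k :: complex
    by (rule partial_derivI) simp
  have "?P i (\<lambda>y. \<mu> * a y) x = ?P i (\<lambda>x. - (1/2) * laplacian a x
      + (of_real (harmonic_potential \<gamma> x) + c + \<beta> * (a x * cnj (a x)) + \<beta>' * (b x * cnj (b x))) * a x
      + w * b x) x"
    by (simp only: E)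
  \<comment> \<open>The third summand is the derivative of the coefficient. Varying the densities
    turns \<open>\<beta>\<close> into \<open>2 * \<beta>\<close> and creates the couplings to
    \<open>b\<close> and to the conjugate fields.\<close>
  then have E': "\<mu> * ?P i a x = - (1/2) * laplacian (?P i a) x
      + (of_real (harmonic_potential \<gamma> x) + c + \<beta> * (a x * cnj (a x)) + \<beta>' * (b x * cnj (b x))) * ?P i a x
      + (of_real ((\<gamma> $ i)\<^sup>2 * x $ i) + \<beta> * (a x * cnj (?P i a x) + ?P i a x * cnj (a x))
          + \<beta>' * (b x * cnj (?P i b x) + ?P i b x * cnj (b x))) * a x
      + w * ?P i b x"
    by (simp only: partial_deriv_add partial_deriv_cmult partial_deriv_mult const
        partial_deriv_bounded_linear[OF bounded_linear_cnj] harmonic_potential_derivative(2)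
        partial_deriv_laplacian(2)[OF a] D differentiable_add differentiable_mult
        differentiable_const simp_thms add_0_right add_0_left add.assoc)
  \<comment> \<open>Solving the equation and its derivative for their Laplacians lets both be
    substituted; a polynomial identity remains.\<close>
  have solve: "l = 2 * (m - z)" if "z = - (1/2) * l + m" for l m z :: complex
    using that by (simp add: field_simps)
  note lap = solve[OF E[of x, unfolded add.assoc]] solve[OF E'[unfolded add.assoc]]
  show ?thesis
    unfolding laplacian_ladder[OF a] lap by (simp add: algebra_simps power2_eq_square)
qed

section \<open>Integrating a partial derivative\<close>

text \<open>The product form makes the integral factor into one-dimensional integrals of
  \<open>inverse (1 + x^2)\<close>. This weight is the majorant in all integrability arguments
  below.\<close>

lemma integrable_prod_inverse_square:
  "integrable lborel (\<lambda>x::'a::euclidean_space. \<Prod>b\<in>Basis. inverse (1 + (x \<bullet> b)\<^sup>2))"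
proof (rule integrableI_nonneg)
  have fin: "(\<integral>\<^sup>+x. ennreal (inverse (1 + x\<^sup>2)) \<partial>lborel) < \<infinity>"
    using integrable_inverse_1_plus_square
    by (simp add: set_integrable_def integrable_iff_bounded)
  have "(\<integral>\<^sup>+x. ennreal (\<Prod>b\<in>(Basis::'a set). inverse (1 + (x \<bullet> b)\<^sup>2)) \<partial>lborel)
     = (\<integral>\<^sup>+x. (\<Prod>b\<in>(Basis::'a set). ennreal (inverse (1 + (x \<bullet> b)\<^sup>2))) \<partial>lborel)"
    by (subst prod_ennreal) auto
  also have "\<dots> = (\<Prod>b\<in>(Basis::'a set). \<integral>\<^sup>+x. ennreal (inverse (1 + x\<^sup>2)) \<partial>lborel)"
    by (rule nn_integral_lborel_prod[where f = "\<lambda>_ x. ennreal (inverse (1 + x\<^sup>2))"]) auto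
  also have "\<dots> < \<infinity>"
    using fin by (simp add: power_less_top_ennreal)
  finally show "(\<integral>\<^sup>+x. ennreal (\<Prod>b\<in>(Basis::'a set). inverse (1 + (x \<bullet> b)\<^sup>2)) \<partial>lborel) < \<infinity>" .
qed (auto intro!: prod_nonneg)

text \<open>Each of the \<open>DIM('a)\<close> factors \<open>1 + (x \<bullet> b)^2\<close> is at
  most \<open>(1 + norm x)^2\<close>, whence the exponent. Decay of that order is thereby turned
  into a bound by the integrable weight.\<close>

lemma prod_inverse_square_ge:
  fixes x :: "'a::euclidean_space"
  shows "1 \<le> (1 + norm x) ^ (2 * DIM('a)) * (\<Prod>b\<in>Basis. inverse (1 + (x \<bullet> b)\<^sup>2))"
proof -
  have "(\<Prod>b\<in>(Basis::'a set). 1 + (x \<bullet> b)\<^sup>2) \<le> (\<Prod>b\<in>(Basis::'a set). (1 + norm x)\<^sup>2)"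
  proof (rule prod_mono)
    fix b :: 'a assume "b \<in> Basis"
    then have "(x \<bullet> b)\<^sup>2 \<le> (norm x)\<^sup>2"
      using power_mono[OF Basis_le_norm[of b x], of 2] by simp
    then show "0 \<le> 1 + (x \<bullet> b)\<^sup>2 \<and> 1 + (x \<bullet> b)\<^sup>2 \<le> (1 + norm x)\<^sup>2"
      by (simp add: power2_sum add_increasing2)
  qed
  moreover have "(\<Prod>b\<in>(Basis::'a set). 1 + (x \<bullet> b)\<^sup>2) > 0"
    by (intro prod_pos) (simp add: add_pos_nonneg)
  ultimately show ?thesis
    by (simp only: prod_inversef[unfolded o_def] prod_constant power_mult)
      (simp add: pos_le_divide_eq flip: divide_inverse)
qed

text \<open>By translation invariance all difference quotients of \<open>F\<close> in a coordinate direction have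
  integral \<open>0\<close>; the decay of the derivative dominates them, so the same holds in the limit.\<close>

lemma integral_partial_deriv_eq_0:
  fixes F :: "real^'d::finite \<Rightarrow> real"
  assumes diff: "\<And>x. F differentiable (at x)"
    and int: "integrable lborel F"
    and bound: "\<And>x. (1 + norm x) ^ (2 * CARD('d)) * \<bar>partial_deriv i F x\<bar> \<le> C"
  shows "integrable lborel (partial_deriv i F)" "integral\<^sup>L lborel (partial_deriv i F) = 0"
proof -
  let ?n = "2 * CARD('d)" and ?e = "axis i 1 :: real^'d"
  define W where "W x = (\<Prod>b\<in>Basis. inverse (1 + (x \<bullet> b)\<^sup>2))" for x :: "real^'d"
  define q where "q k x = real (Suc k) * (F (x + (1 / real (Suc k)) *\<^sub>R ?e) - F x)" for k :: nat and x
  have F_meas [measurable]: "F \<in> borel_measurable borel"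
    using diff by (intro borel_measurable_continuous_onI continuous_at_imp_continuous_on)
      (auto intro: differentiable_imp_continuous_within)
  have q_meas: "q k \<in> borel_measurable lborel" for k
    unfolding q_def[abs_def] by measurable
  have lim: "(\<lambda>k. q k x) \<longlonglongrightarrow> partial_deriv i F x" for x
  proof -
    have "((\<lambda>t. F (x + t *\<^sub>R ?e)) has_real_derivative partial_deriv i F x) (at 0)"
      using has_vector_derivative_partial_deriv[OF diff]
      by (simp add: has_real_derivative_iff_has_vector_derivative)
    then have "((\<lambda>h. (F (x + h *\<^sub>R ?e) - F x) / h) \<longlongrightarrow> partial_deriv i F x) (at 0)"
      by (simp add: DERIV_def)
    moreover have "filterlim (\<lambda>k. 1 / real (Suc k)) (at 0) sequentially"
      using LIMSEQ_Suc[OF lim_1_over_n[where 'a = real]] by (simp add: filterlim_at)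
    ultimately have "(\<lambda>k. (F (x + (1 / real (Suc k)) *\<^sub>R ?e) - F x) / (1 / real (Suc k))) \<longlonglongrightarrow> partial_deriv i F x"
      by (rule filterlim_compose)
    then show ?thesis by (simp add: q_def mult.commute)
  qed
  have dom: "norm (q k x) \<le> C * 2 ^ ?n * W x" for k x
  proof -
    obtain s where s: "0 < s" "s < 1 / real (Suc k)"
       "F (x + (1 / real (Suc k)) *\<^sub>R ?e) - F x = 1 / real (Suc k) * partial_deriv i F (x + s *\<^sub>R ?e)"
      using partial_deriv_mean_value[OF diff, of "1 / real (Suc k)" x i] by auto
    define y where "y = x + s *\<^sub>R ?e"
    have q: "q k x = partial_deriv i F y" using s(3) by (simp add: q_def y_def)
    have "s \<le> 1" using s(2) by (rule order_trans[OF less_imp_le]) simp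
    \<comment> \<open>The mean value point \<open>y\<close> lies within distance 1 of
      \<open>x\<close>, so \<open>1 + norm x\<close> is at most \<open>2 * (1 + norm y)\<close>;
      this is the source of the factor \<open>2 ^ ?n\<close>.\<close>
    then have "norm x \<le> 1 + 2 * norm y"
      using norm_triangle_ineq4[of y "s *\<^sub>R ?e"] s(1) norm_ge_zero[of y]
      by (simp add: y_def norm_axis_1 del: norm_ge_zero)
    then have "(1 + norm x) ^ ?n \<le> (2 * (1 + norm y)) ^ ?n"
      by (intro power_mono) auto
    then have "(1 + norm x) ^ ?n * \<bar>q k x\<bar> \<le> 2 ^ ?n * ((1 + norm y) ^ ?n * \<bar>q k x\<bar>)"
      by (simp only: power_mult_distrib mult.assoc[symmetric]) (rule mult_right_mono, auto)
    also have "\<dots> \<le> 2 ^ ?n * C" unfolding q by (intro mult_left_mono bound) auto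
    finally have *: "(1 + norm x) ^ ?n * \<bar>q k x\<bar> \<le> 2 ^ ?n * C" .
    have W: "0 \<le> W x" unfolding W_def by (intro prod_nonneg) auto
    have "\<bar>q k x\<bar> \<le> (1 + norm x) ^ ?n * W x * \<bar>q k x\<bar>"
      using prod_inverse_square_ge[of x] by (intro mult_le_cancel_right1[THEN iffD2]) (simp add: W_def)
    also have "\<dots> \<le> 2 ^ ?n * C * W x"
      using mult_right_mono[OF * W] by (simp add: mult_ac)
    finally show ?thesis by (simp add: mult_ac)
  qed
  have dominated: "integrable lborel (\<lambda>x. C * 2 ^ ?n * W x)"
    unfolding W_def by (intro integrable_mult_right integrable_prod_inverse_square)
  have P_meas: "partial_deriv i F \<in> borel_measurable lborel"
    using lim q_meas by (rule borel_measurable_LIMSEQ_real)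
  note dc = P_meas q_meas dominated AE_I2[OF lim] AE_I2[OF dom]
  show "integrable lborel (partial_deriv i F)"
    by (rule integrable_dominated_convergence[OF dc])
  have "integral\<^sup>L lborel (q k) = 0" for k
  proof -
    let ?c = "(1 / real (Suc k)) *\<^sub>R ?e"
    have "integrable (distr lborel borel ((+) ?c)) F"
      using int by (simp add: lborel_distr_plus)
    then have shift: "integrable lborel (\<lambda>x. F (x + ?c))"
      by (subst (asm) integrable_distr_eq) (auto simp: add.commute)
    have "integral\<^sup>L lborel F = integral\<^sup>L (distr lborel borel ((+) ?c)) F"
      by (simp add: lborel_distr_plus)
    also have "\<dots> = (\<integral>x. F (x + ?c) \<partial>lborel)"
      by (subst integral_distr) (auto simp: add.commute)
    finally show ?thesis
      using shift int by (simp add: q_def[abs_def])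
  qed
  then have "(\<lambda>k. integral\<^sup>L lborel (q k)) \<longlonglongrightarrow> 0" by simp
  then show "integral\<^sup>L lborel (partial_deriv i F) = 0"
    using integral_dominated_convergence[OF dc] LIMSEQ_unique by blast
qed

section \<open>Decay of Schwartz functions and integration by parts\<close>

lemma schwartz_smooth: "schwartz f \<Longrightarrow> smooth f"
  by (auto simp: schwartz_def smooth_def)

text \<open>Pure powers of the norm give no weight at the origin. Splitting one factor
  \<open>1 + norm x\<close> into its two summands raises \<open>m\<close> by one at the cost of the
  bounds for \<open>k\<close> and \<open>Suc k\<close>, hence the generalisation over
  \<open>k\<close>.\<close>

lemma schwartz_decay:
  assumes "schwartz f"
  shows "\<exists>C. \<forall>x. (1 + norm x) ^ m * norm (foldr partial_deriv is f x) \<le> C"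
proof -
  let ?g = "foldr partial_deriv is f"
  have "\<exists>C. \<forall>x. norm x ^ k * (1 + norm x) ^ m * norm (?g x) \<le> C" for k
  proof (induction m arbitrary: k)
    case 0
    have "bounded (range (\<lambda>x. norm x ^ k *\<^sub>R ?g x))"
      using assms by (simp add: schwartz_def)
    then show ?case by (auto simp: bounded_iff)
  next
    case (Suc m)
    obtain C C' where
      "\<And>x. norm x ^ k * (1 + norm x) ^ m * norm (?g x) \<le> C"
      "\<And>x. norm x ^ Suc k * (1 + norm x) ^ m * norm (?g x) \<le> C'"
      using Suc by metis
    from add_mono[OF this] show ?case
      by (intro exI[of _ "C + C'"]) (simp add: algebra_simps)
  qed
  from this[of 0] show ?thesis by simp
qed

lemma integrable_decay:
  fixes g :: "real^'d::finite \<Rightarrow> real"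
  assumes diff: "\<And>x. g differentiable (at x)"
    and bound: "\<And>x. (1 + norm x) ^ (2 * CARD('d)) * \<bar>g x\<bar> \<le> C"
  shows "integrable lborel g"
proof (rule Bochner_Integration.integrable_bound)
  let ?W = "\<lambda>x::real^'d. \<Prod>b\<in>Basis. inverse (1 + (x \<bullet> b)\<^sup>2)"
  show "integrable lborel (\<lambda>x. C * ?W x)"
    by (intro integrable_mult_right integrable_prod_inverse_square)
  show "g \<in> borel_measurable lborel"
    using diff by (simp, intro borel_measurable_continuous_onI continuous_at_imp_continuous_on)
      (auto intro: differentiable_imp_continuous_within)
  show "AE x in lborel. norm (g x) \<le> norm (C * ?W x)"
  proof (rule AE_I2)
    fix x :: "real^'d"
    have W: "0 \<le> ?W x" by (intro prod_nonneg) auto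
    have "\<bar>g x\<bar> \<le> (1 + norm x) ^ (2 * CARD('d)) * ?W x * \<bar>g x\<bar>"
      using prod_inverse_square_ge[of x] by (intro mult_le_cancel_right1[THEN iffD2]) simp
    also have "\<dots> \<le> C * ?W x"
      using mult_right_mono[OF bound[of x] W] by (simp add: mult_ac)
    finally show "norm (g x) \<le> norm (C * ?W x)" by simp
  qed
qed

text \<open>Integration by parts: the derivative of \<open>x $ i\<close> times the squared norm of
  \<open>f\<close> has integral zero, and the product rule splits it into the two integrands. The
  inner product is the real one, so the factor 2 is exact.\<close>

lemma schwartz_integral_coordinate_deriv:
  fixes f :: "real^'d::finite \<Rightarrow> 'b::real_inner"
  assumes f: "schwartz f"
  shows "(\<integral>x. 2 * (x $ i * (f x \<bullet> partial_deriv i f x)) \<partial>lborel) = - (\<integral>x. (norm (f x))\<^sup>2 \<partial>lborel)"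
proof -
  let ?n = "2 * CARD('d)" and ?P = "partial_deriv i f"
  define F where "F x = x $ i * (f x \<bullet> f x)" for x
  define G where "G x = f x \<bullet> f x + 2 * (x $ i * (f x \<bullet> ?P x))" for x
  have df: "f differentiable (at x)" for x
    using f by (intro smooth_differentiable schwartz_smooth)
  have dff: "(\<lambda>x. f x \<bullet> f x) differentiable (at x)" for x
    using df by (intro differentiable_inner)
  have di: "(\<lambda>x::real^'d. x $ i) differentiable (at x)" for x
    by (rule bounded_linear_imp_differentiable[OF bounded_linear_vec_nth])
  have dF: "F differentiable (at x)" for x
    unfolding F_def[abs_def] using dff di by (intro differentiable_mult)
  have Pff: "partial_deriv i (\<lambda>x. f x \<bullet> f x) x = 2 * (f x \<bullet> ?P x)" for x
    using bounded_bilinear.has_vector_derivative[OF bounded_bilinear_inner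
        has_vector_derivative_partial_deriv[OF df] has_vector_derivative_partial_deriv[OF df], of x i x i]
    by (intro partial_derivI) (simp add: inner_commute)
  have PF: "partial_deriv i F = G"
    using partial_deriv_mult[OF di dff, of i] partial_deriv_coordinate[where 'b = real, of i i]
    by (simp add: F_def[abs_def] G_def fun_eq_iff Pff)
  \<comment> \<open>One power beyond \<open>?n\<close> pays for the coordinate factor. This copy of
    \<open>f\<close> carries all the decay; the other factor, \<open>f\<close> or its derivative, is
    merely bounded by \<open>B\<close> or \<open>B'\<close>.\<close>
  obtain C where C: "\<And>x. (1 + norm x) ^ Suc ?n * norm (f x) \<le> C"
    using schwartz_decay[OF f, of "Suc ?n" "[]"] by auto
  obtain B where B: "\<And>x. norm (f x) \<le> B"
    using schwartz_decay[OF f, of 0 "[]"] by auto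
  obtain B' where B': "\<And>x. norm (?P x) \<le> B'"
    using schwartz_decay[OF f, of 0 "[i]"] by auto
  have B0: "0 \<le> B" "0 \<le> B'"
    using order_trans[OF norm_ge_zero B] order_trans[OF norm_ge_zero B'] by auto
  have decay: "(1 + norm x) ^ ?n * \<bar>g\<bar> \<le> C * K"
    if "\<bar>g\<bar> \<le> (1 + norm x) * norm (f x) * K" "0 \<le> K" for g K x
  proof -
    have "(1 + norm x) ^ ?n * \<bar>g\<bar> \<le> (1 + norm x) ^ ?n * ((1 + norm x) * norm (f x) * K)"
      using that(1) by (intro mult_left_mono) auto
    also have "\<dots> = (1 + norm x) ^ Suc ?n * norm (f x) * K" by (simp add: mult_ac)
    also have "\<dots> \<le> C * K" using C that(2) by (rule mult_right_mono)
    finally show ?thesis .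
  qed
  have ff: "\<bar>f x \<bullet> f x\<bar> \<le> norm (f x) * B" for x
    using Cauchy_Schwarz_ineq2[of "f x" "f x"] mult_left_mono[OF B[of x], of "norm (f x)"] by simp
  have ffP: "\<bar>f x \<bullet> ?P x\<bar> \<le> norm (f x) * B'" for x
    using Cauchy_Schwarz_ineq2[of "f x" "?P x"] mult_left_mono[OF B'[of x], of "norm (f x)"] by simp
  have xi: "\<bar>x $ i * z\<bar> \<le> norm x * K" if "\<bar>z\<bar> \<le> K" for x :: "real^'d" and z K
    unfolding abs_mult using that by (intro mult_mono component_le_norm_cart) auto
  have nn: "0 \<le> norm x * norm (f x) * K" "0 \<le> norm (f x) * K" if "0 \<le> K" for x K
    using that by auto
  have int_ff: "integrable lborel (\<lambda>x. f x \<bullet> f x)"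
  proof (rule integrable_decay[OF dff], rule decay)
    show "\<bar>f x \<bullet> f x\<bar> \<le> (1 + norm x) * norm (f x) * B" for x
      using ff[of x] nn[OF B0(1), of x] by (simp add: algebra_simps)
  qed (rule B0)
  have int_F: "integrable lborel F"
  proof (rule integrable_decay[OF dF], rule decay)
    show "\<bar>F x\<bar> \<le> (1 + norm x) * norm (f x) * B" for x
      using xi[OF ff, of x x] nn[OF B0(1), of x] by (simp add: F_def algebra_simps)
  qed (rule B0)
  have bound_G: "(1 + norm x) ^ ?n * \<bar>partial_deriv i F x\<bar> \<le> C * (B + 2 * B')" for x
  proof (rule decay)
    have "\<bar>G x\<bar> \<le> \<bar>f x \<bullet> f x\<bar> + 2 * \<bar>x $ i * (f x \<bullet> ?P x)\<bar>"
      unfolding G_def by linarith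
    also have "\<dots> \<le> norm (f x) * B + 2 * (norm x * (norm (f x) * B'))"
      by (intro add_mono mult_left_mono ff xi ffP) auto
    also have "\<dots> \<le> (1 + norm x) * norm (f x) * (B + 2 * B')"
      using nn[OF B0(1), of x] nn[OF B0(2), of x] by (simp add: algebra_simps)
    finally show "\<bar>partial_deriv i F x\<bar> \<le> (1 + norm x) * norm (f x) * (B + 2 * B')"
      unfolding PF .
  qed (use B0 in simp)
  note zero = integral_partial_deriv_eq_0[OF dF int_F bound_G, unfolded PF]
  have "(\<integral>x. 2 * (x $ i * (f x \<bullet> ?P x)) \<partial>lborel) = (\<integral>x. G x - f x \<bullet> f x \<partial>lborel)"
    by (simp add: G_def)
  also have "\<dots> = - (\<integral>x. (norm (f x))\<^sup>2 \<partial>lborel)"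
    using zero int_ff by (simp add: power2_norm_eq_inner)
  finally show ?thesis .
qed

section \<open>The Bogoliubov-de Gennes equation\<close>

lemma bounded_linear_conj_vec: "bounded_linear (\<lambda>v::complex^'n::finite. \<chi> j. cnj (v $ j))"
  by (simp add: linear_conv_bounded_linear[symmetric] linear_iff vec_eq_iff)

lemma norm_conj_vec: "norm (\<chi> j. cnj (v $ j)) = norm (v :: complex^'n::finite)"
  by (simp add: norm_vec_def)

theorem theorem2:
  fixes \<gamma> :: "real^'d::finite"
    and \<delta> \<Omega> \<mu> :: real
    and \<beta> :: "real^2^2"
    and \<Phi> :: "real^'d \<Rightarrow> complex^2"
    and \<sigma> :: 'd
  assumes "CARD('d) \<in> {1, 2, 3}"
    and "\<And>i. \<gamma> $ i > 0"
    and "\<Omega> \<noteq> 0"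
    and "\<beta> $ 1 $ 2 = \<beta> $ 2 $ 1"
    and "stationary_state \<gamma> \<delta> \<Omega> \<beta> \<mu> \<Phi>"
  shows "bdg_solution \<gamma> \<delta> \<Omega> \<beta> \<mu> \<Phi> (\<gamma> $ \<sigma>)
    (\<lambda>x. (1 / sqrt 2) *\<^sub>R
        ((\<gamma> $ \<sigma>) powr (-1/2) *\<^sub>R partial_deriv \<sigma> \<Phi> x
         - (\<gamma> $ \<sigma>) powr (1/2) *\<^sub>R (x $ \<sigma>) *\<^sub>R \<Phi> x))
    (\<lambda>x. (1 / sqrt 2) *\<^sub>R
        ((\<gamma> $ \<sigma>) powr (-1/2) *\<^sub>R partial_deriv \<sigma> (conj_field \<Phi>) x
         + (\<gamma> $ \<sigma>) powr (1/2) *\<^sub>R (x $ \<sigma>) *\<^sub>R conj_field \<Phi> x))"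
    (is "bdg_solution _ _ _ _ _ _ _ ?u ?v")
proof -
  let ?P = "partial_deriv \<sigma>" and ?g = "\<gamma> $ \<sigma>"
  define u v where "u = ?u" and "v = ?v"
  define p where "p = ?g powr (-1/2)"
  define r where "r = ?g powr (1/2)"
  have csq: "(complex_of_real (cmod z))\<^sup>2 = z * cnj z" for z
    by (simp add: complex_norm_square flip: of_real_power)
  have g: "?g > 0" using assms(2) .
  have pr: "p * r = 1" using g by (simp add: p_def r_def flip: powr_add)
  have "r * r = ?g" using g by (simp add: r_def flip: powr_add)
  then have rp: "r = ?g * p" using pr by (metis mult.assoc mult.commute mult.right_neutral)
  \<comment> \<open>The ladder coefficients: \<open>s\<close> goes with the derivative and, because
    \<open>r = ?g * p\<close>, the coordinate term has coefficient \<open>?g * s\<close> up to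
    sign.\<close>
  define s :: complex where "s = of_real (p / sqrt 2)"
  let ?t = "of_real ?g * s"
  have t: "?t = of_real (r / sqrt 2)" by (simp add: s_def rp)
  have sch: "schwartz \<Phi>" and norm1: "(\<integral>x. (cmod (\<Phi> x $ 1))\<^sup>2 + (cmod (\<Phi> x $ 2))\<^sup>2 \<partial>lborel) = 1"
    using assms(5) by (auto simp: stationary_state_def)
  note sm = schwartz_smooth[OF sch]
  define a b where "a = (\<lambda>y. \<Phi> y $ 1)" and "b = (\<lambda>y. \<Phi> y $ 2)"
  have ab: "\<Phi> x $ 1 = a x" "\<Phi> x $ 2 = b x" for x by (simp_all add: a_def b_def)
  have sab: "smooth a" "smooth b"
    unfolding a_def b_def by (rule smooth_bounded_linear[OF bounded_linear_vec_nth sm])+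
  let ?a = "\<lambda>y. cnj (a y)" and ?b = "\<lambda>y. cnj (b y)"
  have sab': "smooth ?a" "smooth ?b"
    using sab by (auto intro: smooth_bounded_linear[OF bounded_linear_cnj])
  note Pcnj = partial_deriv_bounded_linear[OF bounded_linear_cnj smooth_differentiable[OF sab(1)]]
    partial_deriv_bounded_linear[OF bounded_linear_cnj smooth_differentiable[OF sab(2)]]
  note Lcnj = laplacian_bounded_linear[OF bounded_linear_cnj sab(1)]
    laplacian_bounded_linear[OF bounded_linear_cnj sab(2)]
  have comp: "?P \<Phi> x $ 1 = ?P a x" "?P \<Phi> x $ 2 = ?P b x" for x
    unfolding a_def b_def
    by (simp_all add: partial_deriv_bounded_linear[OF bounded_linear_vec_nth smooth_differentiable[OF sm]])
  have conj: "conj_field \<Phi> = (\<lambda>y. \<chi> j. cnj (\<Phi> y $ j))"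
    by (simp add: conj_field_def fun_eq_iff)
  have Pconj: "?P (conj_field \<Phi>) x = (\<chi> j. cnj (?P \<Phi> x $ j))" for x
    unfolding conj by (rule partial_deriv_bounded_linear[OF bounded_linear_conj_vec smooth_differentiable[OF sm]])
  have u: "u x = (1 / sqrt 2) *\<^sub>R (p *\<^sub>R ?P \<Phi> x - r *\<^sub>R (x $ \<sigma>) *\<^sub>R \<Phi> x)" for x
    by (simp add: u_def p_def r_def)
  have v: "v x = (1 / sqrt 2) *\<^sub>R (p *\<^sub>R (\<chi> j. cnj (?P \<Phi> x $ j))
      + r *\<^sub>R (x $ \<sigma>) *\<^sub>R (\<chi> j. cnj (\<Phi> x $ j)))" for x
    by (simp add: v_def p_def r_def Pconj conj_field_def)
  have u1: "u x $ 1 = s * ?P a x + (- ?t) * (of_real (x $ \<sigma>) * a x)"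
    "u x $ 2 = s * ?P b x + (- ?t) * (of_real (x $ \<sigma>) * b x)" for x
    unfolding t u vector_minus_component vector_scaleR_component comp
    by (simp_all add: s_def a_def b_def scaleR_conv_of_real algebra_simps)
  have v1: "v x $ 1 = s * ?P ?a x + ?t * (of_real (x $ \<sigma>) * ?a x)"
    "v x $ 2 = s * ?P ?b x + ?t * (of_real (x $ \<sigma>) * ?b x)" for x
    unfolding t v vector_add_component vector_scaleR_component vec_lambda_beta comp Pcnj
    by (simp_all add: s_def a_def b_def scaleR_conv_of_real algebra_simps)
  let ?V = "\<lambda>x. of_real (harmonic_potential \<gamma> x) :: complex"
  let ?\<beta> = "\<lambda>i j. of_real (\<beta> $ i $ j) :: complex"
  have E1: "of_real \<mu> * a x = - (1/2) * laplacian a x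
      + (?V x + of_real (\<delta>/2) + ?\<beta> 1 1 * (a x * cnj (a x)) + ?\<beta> 1 2 * (b x * cnj (b x))) * a x
      + of_real (\<Omega>/2) * b x" for x
    using assms(5) unfolding stationary_state_def a_def b_def
    by (simp add: scaleR_conv_of_real csq)
  \<comment> \<open>Written with the roles of \<open>a\<close> and \<open>b\<close> exchanged, so
    that \<open>linearized_component\<close> applies to the second component too.\<close>
  have E2: "of_real \<mu> * b x = - (1/2) * laplacian b x
      + (?V x + of_real (-\<delta>/2) + ?\<beta> 2 2 * (b x * cnj (b x)) + ?\<beta> 2 1 * (a x * cnj (a x))) * b x
      + of_real (\<Omega>/2) * a x" for x
    using assms(5) unfolding stationary_state_def a_def b_def
    by (simp add: scaleR_conv_of_real csq algebra_simps)
  \<comment> \<open>All coefficients are real, so the conjugate fields satisfy the same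
    equations.\<close>
  have E1': "of_real \<mu> * ?a x = - (1/2) * laplacian ?a x
      + (?V x + of_real (\<delta>/2) + ?\<beta> 1 1 * (?a x * cnj (?a x)) + ?\<beta> 1 2 * (?b x * cnj (?b x))) * ?a x
      + of_real (\<Omega>/2) * ?b x" for x
    using arg_cong[OF E1[of x], of cnj] by (simp add: Lcnj mult_ac)
  have E2': "of_real \<mu> * ?b x = - (1/2) * laplacian ?b x
      + (?V x + of_real (-\<delta>/2) + ?\<beta> 2 2 * (?b x * cnj (?b x)) + ?\<beta> 2 1 * (?a x * cnj (?a x))) * ?b x
      + of_real (\<Omega>/2) * ?a x" for x
    using arg_cong[OF E2[of x], of cnj] by (simp add: Lcnj mult_ac)
  \<comment> \<open>For \<open>t = - ?t\<close> the right-hand side is \<open>?g\<close> times a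
    component of \<open>u\<close>. For the conjugate fields and \<open>t = ?t\<close> it is
    \<open>- ?g\<close> times one of \<open>v\<close>, a sign absorbed by those in
    \<open>bdg_C\<close> and \<open>bdg_D\<close>.\<close>
  note K = linearized_component[where i = \<sigma> and s = s and t = "- ?t", OF sab E1]
    linearized_component[where i = \<sigma> and s = s and t = "- ?t", OF sab(2,1) E2]
    linearized_component[where i = \<sigma> and s = s and t = ?t, OF sab' E1']
    linearized_component[where i = \<sigma> and s = s and t = ?t, OF sab'(2,1) E2']
  have eq1: "bdg_A \<gamma> \<delta> \<Omega> \<beta> \<mu> \<Phi> u x + bdg_B \<beta> \<Phi> x *v v x = ?g *\<^sub>R u x" for x
  proof -
    have "(bdg_A \<gamma> \<delta> \<Omega> \<beta> \<mu> \<Phi> u x + bdg_B \<beta> \<Phi> x *v v x) $ 1 = (?g *\<^sub>R u x) $ 1"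
      unfolding vector_scaleR_component
      unfolding bdg_A_def bdg_B_def L1_def matrix_vector_mult_def u1 v1 ab scaleR_conv_of_real
        of_real_add of_real_diff of_real_mult of_real_power csq
        vector_add_component vec_lambda_beta vector_2 sum_2
      using K(1)[of x]
      by (simp add: Pcnj power2_eq_square algebra_simps)
    moreover have "(bdg_A \<gamma> \<delta> \<Omega> \<beta> \<mu> \<Phi> u x + bdg_B \<beta> \<Phi> x *v v x) $ 2 = (?g *\<^sub>R u x) $ 2"
      unfolding vector_scaleR_component
      unfolding bdg_A_def bdg_B_def L2_def matrix_vector_mult_def u1 v1 ab scaleR_conv_of_real
        of_real_add of_real_diff of_real_mult of_real_power csq
        vector_add_component vec_lambda_beta vector_2 sum_2
      using K(2)[of x]
      by (simp add: Pcnj power2_eq_square algebra_simps)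
    ultimately show ?thesis by (simp only: vec_eq_iff forall_2)
  qed
  have eq2: "bdg_C \<beta> \<Phi> x *v u x + bdg_D \<gamma> \<delta> \<Omega> \<beta> \<mu> \<Phi> v x = ?g *\<^sub>R v x" for x
  proof -
    have "(bdg_C \<beta> \<Phi> x *v u x + bdg_D \<gamma> \<delta> \<Omega> \<beta> \<mu> \<Phi> v x) $ 1 = (?g *\<^sub>R v x) $ 1"
      unfolding vector_scaleR_component
      unfolding bdg_C_def bdg_D_def L1_def matrix_vector_mult_def u1 v1 ab scaleR_conv_of_real
        of_real_add of_real_diff of_real_mult of_real_power csq
        vector_add_component vec_lambda_beta vector_2 sum_2 vector_uminus_component
      using K(3)[of x]
      by (simp add: Pcnj power2_eq_square algebra_simps)
    moreover have "(bdg_C \<beta> \<Phi> x *v u x + bdg_D \<gamma> \<delta> \<Omega> \<beta> \<mu> \<Phi> v x) $ 2 = (?g *\<^sub>R v x) $ 2"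
      unfolding vector_scaleR_component
      unfolding bdg_C_def bdg_D_def L2_def matrix_vector_mult_def u1 v1 ab scaleR_conv_of_real
        of_real_add of_real_diff of_real_mult of_real_power csq
        vector_add_component vec_lambda_beta vector_2 sum_2 vector_uminus_component
      using K(4)[of x]
      by (simp add: Pcnj power2_eq_square algebra_simps)
    ultimately show ?thesis by (simp only: vec_eq_iff forall_2)
  qed
  have "(norm (u x))\<^sup>2 - (norm (v x))\<^sup>2 = - (2 * (x $ \<sigma> * (\<Phi> x \<bullet> ?P \<Phi> x)))" for x
  proof -
    \<comment> \<open>Conjugating \<open>v\<close> preserves its norm and gives \<open>u\<close>
      with the opposite sign on the coordinate term. By polarization only the cross term survives,
      with coefficient \<open>p * r = 1\<close>.\<close>
    let ?w = "(1 / sqrt 2) *\<^sub>R (p *\<^sub>R ?P \<Phi> x + r *\<^sub>R (x $ \<sigma>) *\<^sub>R \<Phi> x)"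
    have "v x = (\<chi> j. cnj (?w $ j))"
      by (simp add: vec_eq_iff v)
    then have nv: "norm (v x) = norm ?w" by (simp only: norm_conj_vec)
    have "(norm (u x))\<^sup>2 - (norm ?w)\<^sup>2 = - (2 * (p * r) * (x $ \<sigma> * (\<Phi> x \<bullet> ?P \<Phi> x)))"
      unfolding power2_norm_eq_inner u
      by (simp add: inner_simps inner_commute field_simps)
    then show ?thesis by (simp only: nv pr)
  qed
  then have "(\<integral>x. (norm (u x))\<^sup>2 - (norm (v x))\<^sup>2 \<partial>lborel)
      = - (\<integral>x. 2 * (x $ \<sigma> * (\<Phi> x \<bullet> ?P \<Phi> x)) \<partial>lborel)"
    by simp
  also have "\<dots> = (\<integral>x. (norm (\<Phi> x))\<^sup>2 \<partial>lborel)"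
    by (simp only: schwartz_integral_coordinate_deriv[OF sch] minus_minus)
  also have "\<dots> = 1"
    using norm1 by (simp add: norm_vec_def L2_set_def sum_2)
  finally show ?thesis
    unfolding bdg_solution_def u_def[symmetric] v_def[symmetric] using eq1 eq2 by blast
qed

end
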